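(* Let $\Sigma=(X,X_0,S,U,\to,Y,h)$ be a total NFTS and $\Sigma_V$ its verification system with state set $X_V$. Then $\Sigma$ is infinite-step opaque if and only if for every $(q^1,q^2)\in X_V$: if $q^1\cap q^2\neq\emptyset$ then $q^1\cap q^2\not\subseteq S$.
   Context: An NFTS is a tuple $\Sigma=(X,X_0,S,U,\to,Y,h)$ with $X$ a finite set of states, $X_0\subseteq X$ initial states, $S\subseteq X$ secret states, $U$ a finite set of inputs, $\to\subseteq X\times U\times X$ the transition relation (write $x\xrightarrow{u}x'$), $Y$ a set of outputs and $h:X\to Y$. It is total if for every $x\in X$, $u\in U$ there is $x'$ with $x\xrightarrow{u}x'$. For $\alpha=\alpha(0)\cdots\alpha(|\alpha|-1)\in U^*$ (finite sequences, including empty), a run over $\alpha$ is a nonempty sequence $x_0\dots x_k$ with $k\le|\alpha|$, $x_0\in X_0$, $(x_j,\alpha(j),x_{j+1})\in\to$ for $j<k$; it is maximal if $k=|\alpha|$ or no $x'$ satisfies $(x_k,\alpha(k),x')\in\to$. $\Sigma$ is infinite-step opaque if for every $\alpha\in U^*$, every maximal run $x_0\dots x_k$ over $\alpha$ and every $i\in\{0,\dots,k\}$ with $x_i\in S$, there is a maximal run $x_0'\dots x_k'$ over $\alpha$ with $x_i'\notin S$ and $h(x_j)=h(x_j')$ for all $j\in\{0,\dots,k\}$. For $y\in Y$ let $X_y=\{x\mid h(x)=y\}$, $X_{0,y}=X_0\cap X_y$; for $q\subseteq X$, $u\in U$, $\mathrm{suc}(q,u)=\{x\mid\exists x'\in q,(x',u,x)\in\to\}$,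 $\mathrm{post}(q,u)=\{x\mid\exists x'\in q,(x,u,x')\in\to\}$. Let $\epsilon\notin U$. The verification system $\Sigma_V$ has input set $U_V=(U\times\{\epsilon\})\cup(\{\epsilon\}\times U)$, initial states $X_{V,0}=\{(X_{0,y_1},X_{y_2})\mid y_1,y_2\in Y,\ X_{0,y_1}\neq\emptyset,\ X_{y_2}\neq\emptyset\}$, transitions $(q_1,q_2)\xrightarrow{(u,\epsilon)}_V(q_1',q_2)$ iff $q_1'=\mathrm{suc}(q_1,u)\cap X_y\neq\emptyset$ for some $y\in Y$, and $(q_1,q_2)\xrightarrow{(\epsilon,u)}_V(q_1,q_2')$ iff $q_2'=\mathrm{post}(q_2,u)\cap X_y\neq\emptyset$ for some $y\in Y$; its state set $X_V$ is the set of pairs reachable from $X_{V,0}$ by finitely many transitions. *)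

theory Defs
  imports "HOL-Library.FuncSet"
begin

record ('x, 'u, 'y) nfts_data =
  states :: "'x set"
  inits :: "'x set"
  secrets :: "'x set"
  inputs :: "'u set"
  transitions :: "('x \<times> 'u \<times> 'x) set"
  outputs :: "'y set"
  obs :: "'x \<Rightarrow> 'y"

definition nfts :: "('x, 'u, 'y) nfts_data \<Rightarrow> bool" where
  "nfts \<Sigma> \<longleftrightarrow>
     finite (states \<Sigma>) \<and>
     inits \<Sigma> \<subseteq> states \<Sigma> \<and>
     secrets \<Sigma> \<subseteq> states \<Sigma> \<and>
     finite (inputs \<Sigma>) \<and>
     transitions \<Sigma> \<subseteq> states \<Sigma> \<times> inputs \<Sigma> \<times> states \<Sigma> \<and>
     obs \<Sigma> \<in> states \<Sigma> \<rightarrow> outputs \<Sigma>"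

definition total_nfts :: "('x, 'u, 'y) nfts_data \<Rightarrow> bool" where
  "total_nfts \<Sigma> \<longleftrightarrow> nfts \<Sigma> \<and>
     (\<forall>x\<in>states \<Sigma>. \<forall>u\<in>inputs \<Sigma>. \<exists>x'. (x, u, x') \<in> transitions \<Sigma>)"

text \<open>A run $x_0 \ldots x_k$ is the list of its states, so $k$ is the length of the list minus one.\<close>

definition run :: "('x, 'u, 'y) nfts_data \<Rightarrow> 'u list \<Rightarrow> 'x list \<Rightarrow> bool" where
  "run \<Sigma> \<alpha> xs \<longleftrightarrow>
     xs \<noteq> [] \<and> length xs - 1 \<le> length \<alpha> \<and> xs ! 0 \<in> inits \<Sigma> \<and>
     (\<forall>j < length xs - 1. (xs ! j, \<alpha> ! j, xs ! (j + 1)) \<in> transitions \<Sigma>)"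

definition maximal_run :: "('x, 'u, 'y) nfts_data \<Rightarrow> 'u list \<Rightarrow> 'x list \<Rightarrow> bool" where
  "maximal_run \<Sigma> \<alpha> xs \<longleftrightarrow> run \<Sigma> \<alpha> xs \<and>
     (let k = length xs - 1 in
        k = length \<alpha> \<or> \<not> (\<exists>x'. (xs ! k, \<alpha> ! k, x') \<in> transitions \<Sigma>))"

definition infinite_step_opaque :: "('x, 'u, 'y) nfts_data \<Rightarrow> bool" where
  "infinite_step_opaque \<Sigma> \<longleftrightarrow>
     (\<forall>\<alpha>\<in>lists (inputs \<Sigma>). \<forall>xs. maximal_run \<Sigma> \<alpha> xs \<longrightarrow>
        (\<forall>i < length xs. xs ! i \<in> secrets \<Sigma> \<longrightarrow>
           (\<exists>xs'. maximal_run \<Sigma> \<alpha> xs' \<and> length xs' = length xs \<and>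
              xs' ! i \<notin> secrets \<Sigma> \<and>
              (\<forall>j < length xs. obs \<Sigma> (xs ! j) = obs \<Sigma> (xs' ! j)))))"

definition states_at :: "('x, 'u, 'y) nfts_data \<Rightarrow> 'y \<Rightarrow> 'x set" where
  "states_at \<Sigma> y = {x \<in> states \<Sigma>. obs \<Sigma> x = y}"

definition inits_at :: "('x, 'u, 'y) nfts_data \<Rightarrow> 'y \<Rightarrow> 'x set" where
  "inits_at \<Sigma> y = inits \<Sigma> \<inter> states_at \<Sigma> y"

definition suc :: "('x, 'u, 'y) nfts_data \<Rightarrow> 'x set \<Rightarrow> 'u \<Rightarrow> 'x set" where
  "suc \<Sigma> q u = {x. \<exists>x'\<in>q. (x', u, x) \<in> transitions \<Sigma>}"

text \<open>Despite its name, \<open>post\<close> yields predecessors: the second component of the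
  verification system runs backwards in time.\<close>

definition post :: "('x, 'u, 'y) nfts_data \<Rightarrow> 'x set \<Rightarrow> 'u \<Rightarrow> 'x set" where
  "post \<Sigma> q u = {x. \<exists>x'\<in>q. (x, u, x') \<in> transitions \<Sigma>}"

text \<open>In the inputs of the verification system, \<open>None\<close> plays the role of the fresh
  symbol $\epsilon \notin U$ and \<open>Some u\<close> that of $u \in U$.\<close>

definition ver_inputs :: "('x, 'u, 'y) nfts_data \<Rightarrow> ('u option \<times> 'u option) set" where
  "ver_inputs \<Sigma> = (Some ` inputs \<Sigma> \<times> {None}) \<union> ({None} \<times> Some ` inputs \<Sigma>)"

definition ver_inits :: "('x, 'u, 'y) nfts_data \<Rightarrow> ('x set \<times> 'x set) set" where
  "ver_inits \<Sigma> = {(inits_at \<Sigma> y\<^sub>1, states_at \<Sigma> y\<^sub>2) | y\<^sub>1 y\<^sub>2.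
     y\<^sub>1 \<in> outputs \<Sigma> \<and> y\<^sub>2 \<in> outputs \<Sigma> \<and>
     inits_at \<Sigma> y\<^sub>1 \<noteq> {} \<and> states_at \<Sigma> y\<^sub>2 \<noteq> {}}"

inductive ver_step ::
  "('x, 'u, 'y) nfts_data \<Rightarrow> 'x set \<times> 'x set \<Rightarrow> 'u option \<times> 'u option \<Rightarrow> 'x set \<times> 'x set \<Rightarrow> bool"
  for \<Sigma> where
  forward: "\<lbrakk>u \<in> inputs \<Sigma>; y \<in> outputs \<Sigma>; q\<^sub>1' = suc \<Sigma> q\<^sub>1 u \<inter> states_at \<Sigma> y; q\<^sub>1' \<noteq> {}\<rbrakk>
    \<Longrightarrow> ver_step \<Sigma> (q\<^sub>1, q\<^sub>2) (Some u, None) (q\<^sub>1', q\<^sub>2)"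
| backward: "\<lbrakk>u \<in> inputs \<Sigma>; y \<in> outputs \<Sigma>; q\<^sub>2' = post \<Sigma> q\<^sub>2 u \<inter> states_at \<Sigma> y; q\<^sub>2' \<noteq> {}\<rbrakk>
    \<Longrightarrow> ver_step \<Sigma> (q\<^sub>1, q\<^sub>2) (None, Some u) (q\<^sub>1, q\<^sub>2')"

inductive_set ver_states :: "('x, 'u, 'y) nfts_data \<Rightarrow> ('x set \<times> 'x set) set"
  for \<Sigma> where
  init: "p \<in> ver_inits \<Sigma> \<Longrightarrow> p \<in> ver_states \<Sigma>"
| step: "\<lbrakk>p \<in> ver_states \<Sigma>; w \<in> ver_inputs \<Sigma>; ver_step \<Sigma> p w p'\<rbrakk> \<Longrightarrow> p' \<in> ver_states \<Sigma>"

end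

theory Submission
  imports Defs
begin

text \<open>The reachable states of the verification system are the pairs of a forward estimate (the
  states in which a run over \<open>\<alpha>\<close> with observation \<open>ys\<close> can end) and a backward estimate (the states
  from which a path over \<open>\<beta>\<close> with observation \<open>zs\<close> can start), both nonempty. When the two estimates
  meet, \<open>ys\<close> and \<open>zs\<close> agree at the junction, and gluing a run to a path shows that the intersection
  is the set of states that a run over \<open>\<alpha> @ \<beta>\<close> with the glued observation can occupy at time
  \<open>length \<alpha>\<close>. Totality makes the maximal runs over \<open>\<alpha> @ \<beta>\<close> the full-length ones, so opacity says
  that no such set is nonempty and contained in the secret states.\<close>

definition path :: "('x, 'u, 'y) nfts_data \<Rightarrow> 'u list \<Rightarrow> 'x list \<Rightarrow> bool" where
  "path \<Sigma> \<alpha> xs \<longleftrightarrow> length xs = Suc (length \<alpha>) \<and> set xs \<subseteq> states \<Sigma> \<and>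
     (\<forall>j < length \<alpha>. (xs ! j, \<alpha> ! j, xs ! Suc j) \<in> transitions \<Sigma>)"

definition state_estimate ::
  "('x, 'u, 'y) nfts_data \<Rightarrow> 'x set \<Rightarrow> 'u list \<Rightarrow> 'y list \<Rightarrow> nat \<Rightarrow> 'x set" where
  "state_estimate \<Sigma> I \<alpha> ys i =
     {xs ! i | xs. path \<Sigma> \<alpha> xs \<and> xs ! 0 \<in> I \<and> map (obs \<Sigma>) xs = ys}"

abbreviation forward_estimate :: "('x, 'u, 'y) nfts_data \<Rightarrow> 'u list \<Rightarrow> 'y list \<Rightarrow> 'x set" where
  "forward_estimate \<Sigma> \<alpha> ys \<equiv> state_estimate \<Sigma> (inits \<Sigma>) \<alpha> ys (length \<alpha>)"

abbreviation backward_estimate :: "('x, 'u, 'y) nfts_data \<Rightarrow> 'u list \<Rightarrow> 'y list \<Rightarrow> 'x set" where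
  "backward_estimate \<Sigma> \<beta> zs \<equiv> state_estimate \<Sigma> UNIV \<beta> zs 0"

definition run_estimates :: "('x, 'u, 'y) nfts_data \<Rightarrow> 'x set set" where
  "run_estimates \<Sigma> = {state_estimate \<Sigma> (inits \<Sigma>) \<alpha> ys i | \<alpha> ys i.
     \<alpha> \<in> lists (inputs \<Sigma>) \<and> i \<le> length \<alpha>} - {{}}"

lemma path_length: "path \<Sigma> \<alpha> xs \<Longrightarrow> length xs = Suc (length \<alpha>)"
  by (simp add: path_def)

lemma path_Nil: "path \<Sigma> [] xs \<longleftrightarrow> (\<exists>x\<in>states \<Sigma>. xs = [x])"
  by (auto simp: path_def length_Suc_conv)

lemma path_snoc:
  "path \<Sigma> (\<alpha> @ [u]) (xs @ [x]) \<longleftrightarrow>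
     path \<Sigma> \<alpha> xs \<and> x \<in> states \<Sigma> \<and> (xs ! length \<alpha>, u, x) \<in> transitions \<Sigma>"
  by (auto simp: path_def nth_append less_Suc_eq split: if_splits)

lemma path_Cons:
  "path \<Sigma> (u # \<beta>) (x # xs) \<longleftrightarrow>
     path \<Sigma> \<beta> xs \<and> x \<in> states \<Sigma> \<and> (x, u, xs ! 0) \<in> transitions \<Sigma>"
  by (auto simp: path_def All_less_Suc2)

lemma path_split:
  assumes i_le: "i \<le> length \<alpha>" and len: "length xs = Suc (length \<alpha>)"
  shows "path \<Sigma> \<alpha> xs \<longleftrightarrow> path \<Sigma> (take i \<alpha>) (take (Suc i) xs) \<and> path \<Sigma> (drop i \<alpha>) (drop i xs)"
proof -
  let ?T = "\<lambda>j. (xs ! j, \<alpha> ! j, xs ! Suc j) \<in> transitions \<Sigma>"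
  have "set xs = set (take (Suc i) xs) \<union> set (drop (Suc i) xs)"
    by (metis append_take_drop_id set_append)
  also have "\<dots> = set (take (Suc i) xs) \<union> set (drop i xs)"
    using i_le len by (auto simp: Cons_nth_drop_Suc[symmetric] take_Suc_conv_app_nth)
  finally have states: "set xs \<subseteq> states \<Sigma> \<longleftrightarrow>
      set (take (Suc i) xs) \<subseteq> states \<Sigma> \<and> set (drop i xs) \<subseteq> states \<Sigma>"
    by simp
  have transitions: "(\<forall>j < length \<alpha>. ?T j) \<longleftrightarrow> (\<forall>j < i. ?T j) \<and> (\<forall>j < length \<alpha> - i. ?T (i + j))"
  proof -
    have "j < length \<alpha> \<longleftrightarrow> j < i \<or> (\<exists>l < length \<alpha> - i. j = i + l)" for j
      using i_le by presburger
    then show ?thesis by blast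
  qed
  show ?thesis
    using i_le len unfolding path_def states transitions by auto
qed

lemma state_estimate_length: "x \<in> state_estimate \<Sigma> I \<alpha> ys i \<Longrightarrow> length ys = Suc (length \<alpha>)"
  by (auto simp: state_estimate_def path_length)

lemma state_estimate_obs:
  "x \<in> state_estimate \<Sigma> I \<alpha> ys i \<Longrightarrow> i \<le> length \<alpha> \<Longrightarrow> obs \<Sigma> x = ys ! i"
  by (auto simp: state_estimate_def path_length)

lemma state_estimate_Nil: "state_estimate \<Sigma> I [] [y] 0 = I \<inter> states_at \<Sigma> y"
  by (force simp: state_estimate_def path_Nil states_at_def)

lemma state_estimate_snoc:
  "state_estimate \<Sigma> I (\<alpha> @ [u]) (ys @ [y]) (Suc (length \<alpha>)) =
     suc \<Sigma> (state_estimate \<Sigma> I \<alpha> ys (length \<alpha>)) u \<inter> states_at \<Sigma> y"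
  (is "?L = ?R")
proof (intro equalityI subsetI)
  fix x assume "x \<in> ?L"
  then obtain xs x' where snoc: "path \<Sigma> (\<alpha> @ [u]) (xs @ [x'])" "(xs @ [x']) ! 0 \<in> I"
      "map (obs \<Sigma>) (xs @ [x']) = ys @ [y]" "x = (xs @ [x']) ! Suc (length \<alpha>)"
    by (auto simp: state_estimate_def map_eq_append_conv)
  moreover have "length xs = Suc (length \<alpha>)"
    using path_length[OF snoc(1)] by simp
  ultimately show "x \<in> ?R"
    by (auto simp: path_snoc suc_def states_at_def state_estimate_def nth_append)
next
  fix x assume "x \<in> ?R"
  then obtain xs where "path \<Sigma> \<alpha> xs" "xs ! 0 \<in> I" "map (obs \<Sigma>) xs = ys"
      "(xs ! length \<alpha>, u, x) \<in> transitions \<Sigma>" "x \<in> states \<Sigma>" "obs \<Sigma> x = y"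
    by (auto simp: suc_def states_at_def state_estimate_def)
  then show "x \<in> ?L"
    unfolding state_estimate_def
    by (intro CollectI exI[of _ "xs @ [x]"]) (auto simp: path_snoc nth_append path_length)
qed

lemma backward_estimate_Cons:
  "backward_estimate \<Sigma> (u # \<beta>) (z # zs) = post \<Sigma> (backward_estimate \<Sigma> \<beta> zs) u \<inter> states_at \<Sigma> z"
  (is "?L = ?R")
proof (intro equalityI subsetI)
  fix x assume "x \<in> ?L"
  then obtain xs where "path \<Sigma> (u # \<beta>) (x # xs)" "map (obs \<Sigma>) (x # xs) = z # zs"
    by (auto simp: state_estimate_def)
  then show "x \<in> ?R"
    by (auto simp: path_Cons post_def states_at_def state_estimate_def)
next
  fix x assume "x \<in> ?R"
  then obtain xs where "path \<Sigma> \<beta> xs" "map (obs \<Sigma>) xs = zs"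
      "(x, u, xs ! 0) \<in> transitions \<Sigma>" "x \<in> states \<Sigma>" "obs \<Sigma> x = z"
    by (auto simp: post_def states_at_def state_estimate_def)
  then show "x \<in> ?L"
    unfolding state_estimate_def
    by (intro CollectI exI[of _ "x # xs"]) (auto simp: path_Cons)
qed

lemma drop_append_tl_eq:
  assumes "length xs = Suc i" "ys \<noteq> []" "xs ! i = ys ! 0"
  shows "drop i xs @ tl ys = ys"
  using assms by (cases xs rule: rev_cases; cases ys) auto

lemma take_Suc_append_tl_drop: "take (Suc i) xs @ tl (drop i xs) = xs"
  by (simp only: tl_drop drop_Suc[symmetric] append_take_drop_id)

lemma state_estimate_split:
  assumes i_le: "i \<le> length \<alpha>"
  shows "state_estimate \<Sigma> I \<alpha> ys i =
    state_estimate \<Sigma> I (take i \<alpha>) (take (Suc i) ys) i \<inter> backward_estimate \<Sigma> (drop i \<alpha>) (drop i ys)"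
  (is "?L = ?F \<inter> ?B")
proof (intro equalityI subsetI)
  fix x assume "x \<in> ?L"
  then obtain xs where xs: "path \<Sigma> \<alpha> xs" "xs ! 0 \<in> I" "map (obs \<Sigma>) xs = ys" "x = xs ! i"
    by (auto simp: state_estimate_def)
  have "x \<in> ?F"
    unfolding state_estimate_def using xs path_split[OF i_le path_length[OF xs(1)]]
    by (intro CollectI exI[of _ "take (Suc i) xs"]) (auto simp: take_map)
  moreover have "x \<in> ?B"
    unfolding state_estimate_def using i_le xs path_length[OF xs(1)]
      path_split[OF i_le path_length[OF xs(1)]]
    by (intro CollectI exI[of _ "drop i xs"]) (auto simp: drop_map)
  ultimately show "x \<in> ?F \<inter> ?B" by simp
next
  fix x assume "x \<in> ?F \<inter> ?B"
  then obtain xs xs' where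
    xs: "path \<Sigma> (take i \<alpha>) xs" "xs ! 0 \<in> I" "map (obs \<Sigma>) xs = take (Suc i) ys" "x = xs ! i" and
    xs': "path \<Sigma> (drop i \<alpha>) xs'" "map (obs \<Sigma>) xs' = drop i ys" "x = xs' ! 0"
    by (auto simp: state_estimate_def)
  have lens: "length xs = Suc i" "length xs' = Suc (length \<alpha> - i)"
    using i_le path_length[OF xs(1)] path_length[OF xs'(1)] by auto
  have "take (Suc i) (xs @ tl xs') = xs" "drop i (xs @ tl xs') = xs'"
    using lens xs(4) xs'(3) by (auto intro!: drop_append_tl_eq)
  then have "path \<Sigma> \<alpha> (xs @ tl xs')"
    using i_le lens xs(1) xs'(1) by (simp add: path_split[OF i_le])
  moreover have "map (obs \<Sigma>) (xs @ tl xs') = ys"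
    by (simp add: xs(3) xs'(2) map_tl take_Suc_append_tl_drop del: tl_drop)
  ultimately show "x \<in> ?L"
    unfolding state_estimate_def using lens xs
    by (intro CollectI exI[of _ "xs @ tl xs'"]) (auto simp: nth_append)
qed

lemma forward_estimate_Int_backward_estimate:
  assumes "forward_estimate \<Sigma> \<alpha> ys \<inter> backward_estimate \<Sigma> \<beta> zs \<noteq> {}"
  shows "forward_estimate \<Sigma> \<alpha> ys \<inter> backward_estimate \<Sigma> \<beta> zs =
    state_estimate \<Sigma> (inits \<Sigma>) (\<alpha> @ \<beta>) (ys @ tl zs) (length \<alpha>)"
proof -
  obtain x where x: "x \<in> forward_estimate \<Sigma> \<alpha> ys" "x \<in> backward_estimate \<Sigma> \<beta> zs"
    using assms by blast
  have "length ys = Suc (length \<alpha>)" "length zs = Suc (length \<beta>)"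
    using x by (simp_all add: state_estimate_length)
  moreover have "ys ! length \<alpha> = zs ! 0"
    using state_estimate_obs[OF x(1)] state_estimate_obs[OF x(2)] by simp
  ultimately have "take (Suc (length \<alpha>)) (ys @ tl zs) = ys" "drop (length \<alpha>) (ys @ tl zs) = zs"
    by (auto intro!: drop_append_tl_eq)
  then show ?thesis
    by (subst state_estimate_split) simp_all
qed

lemma states_at_outputs: "nfts \<Sigma> \<Longrightarrow> states_at \<Sigma> y \<noteq> {} \<Longrightarrow> y \<in> outputs \<Sigma>"
  by (auto simp: states_at_def nfts_def)

lemma inits_at_states_at_ver_states:
  assumes "nfts \<Sigma>" "inits_at \<Sigma> y \<noteq> {}" "states_at \<Sigma> z \<noteq> {}"
  shows "(inits_at \<Sigma> y, states_at \<Sigma> z) \<in> ver_states \<Sigma>"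
proof -
  have "y \<in> outputs \<Sigma>" "z \<in> outputs \<Sigma>"
    using assms states_at_outputs[of \<Sigma>] by (auto simp: inits_at_def)
  with assms(2,3) show ?thesis
    by (intro ver_states.init) (auto simp: ver_inits_def)
qed

lemma suc_ver_states:
  assumes "nfts \<Sigma>" "(q\<^sub>1, q\<^sub>2) \<in> ver_states \<Sigma>" "u \<in> inputs \<Sigma>"
    and nonempty: "suc \<Sigma> q\<^sub>1 u \<inter> states_at \<Sigma> y \<noteq> {}"
  shows "(suc \<Sigma> q\<^sub>1 u \<inter> states_at \<Sigma> y, q\<^sub>2) \<in> ver_states \<Sigma>"
proof -
  have "y \<in> outputs \<Sigma>"
    using assms(1) nonempty by (blast intro: states_at_outputs)
  then have "ver_step \<Sigma> (q\<^sub>1, q\<^sub>2) (Some u, None) (suc \<Sigma> q\<^sub>1 u \<inter> states_at \<Sigma> y, q\<^sub>2)"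
    using assms(3) nonempty by (intro ver_step.forward) auto
  moreover have "(Some u, None) \<in> ver_inputs \<Sigma>"
    using assms(3) by (simp add: ver_inputs_def)
  ultimately show ?thesis
    using assms(2) by (blast intro: ver_states.step)
qed

lemma post_ver_states:
  assumes "nfts \<Sigma>" "(q\<^sub>1, q\<^sub>2) \<in> ver_states \<Sigma>" "u \<in> inputs \<Sigma>"
    and nonempty: "post \<Sigma> q\<^sub>2 u \<inter> states_at \<Sigma> z \<noteq> {}"
  shows "(q\<^sub>1, post \<Sigma> q\<^sub>2 u \<inter> states_at \<Sigma> z) \<in> ver_states \<Sigma>"
proof -
  have "z \<in> outputs \<Sigma>"
    using assms(1) nonempty by (blast intro: states_at_outputs)
  then have "ver_step \<Sigma> (q\<^sub>1, q\<^sub>2) (None, Some u) (q\<^sub>1, post \<Sigma> q\<^sub>2 u \<inter> states_at \<Sigma> z)"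
    using assms(3) nonempty by (intro ver_step.backward) auto
  moreover have "(None, Some u) \<in> ver_inputs \<Sigma>"
    using assms(3) by (simp add: ver_inputs_def)
  ultimately show ?thesis
    using assms(2) by (blast intro: ver_states.step)
qed

lemma forward_estimate_states_at_ver_states:
  assumes "nfts \<Sigma>" "states_at \<Sigma> z \<noteq> {}"
    and "\<alpha> \<in> lists (inputs \<Sigma>)" "forward_estimate \<Sigma> \<alpha> ys \<noteq> {}"
  shows "(forward_estimate \<Sigma> \<alpha> ys, states_at \<Sigma> z) \<in> ver_states \<Sigma>"
  using assms(3,4)
proof (induction \<alpha> arbitrary: ys rule: rev_induct)
  case Nil
  then obtain y where "ys = [y]"
    by (auto dest!: state_estimate_length simp: length_Suc_conv)
  with Nil assms(1,2) show ?case
    using inits_at_states_at_ver_states by (simp add: state_estimate_Nil inits_at_def)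
next
  case (snoc u \<alpha>)
  then obtain ys' y where ys: "ys = ys' @ [y]"
    by (cases ys rule: rev_cases) (auto dest: state_estimate_length)
  have "forward_estimate \<Sigma> \<alpha> ys' \<noteq> {}"
    using snoc.prems by (auto simp: ys state_estimate_snoc suc_def)
  with snoc have "(forward_estimate \<Sigma> \<alpha> ys', states_at \<Sigma> z) \<in> ver_states \<Sigma>" by simp
  with snoc.prems show ?case
    by (simp add: ys state_estimate_snoc suc_ver_states[OF assms(1)])
qed

lemma forward_estimate_backward_estimate_ver_states:
  assumes "nfts \<Sigma>"
    and "\<alpha> \<in> lists (inputs \<Sigma>)" "forward_estimate \<Sigma> \<alpha> ys \<noteq> {}"
    and "\<beta> \<in> lists (inputs \<Sigma>)" "backward_estimate \<Sigma> \<beta> zs \<noteq> {}"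
  shows "(forward_estimate \<Sigma> \<alpha> ys, backward_estimate \<Sigma> \<beta> zs) \<in> ver_states \<Sigma>"
  using assms(4,5)
proof (induction \<beta> arbitrary: zs)
  case Nil
  then obtain z where "zs = [z]"
    by (auto dest!: state_estimate_length simp: length_Suc_conv)
  with Nil assms(1-3) show ?case
    by (simp add: state_estimate_Nil forward_estimate_states_at_ver_states)
next
  case (Cons u \<beta>)
  then obtain z zs' where zs: "zs = z # zs'"
    by (cases zs) (auto dest: state_estimate_length)
  have "backward_estimate \<Sigma> \<beta> zs' \<noteq> {}"
    using Cons.prems by (auto simp: zs backward_estimate_Cons post_def)
  with Cons have "(forward_estimate \<Sigma> \<alpha> ys, backward_estimate \<Sigma> \<beta> zs') \<in> ver_states \<Sigma>" by simp
  with Cons.hyps Cons.prems show ?case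
    by (simp add: zs backward_estimate_Cons post_ver_states[OF assms(1)])
qed

lemma ver_statesE:
  assumes "p \<in> ver_states \<Sigma>"
  obtains \<alpha> \<beta> ys zs where "\<alpha> \<in> lists (inputs \<Sigma>)" "\<beta> \<in> lists (inputs \<Sigma>)"
    "p = (forward_estimate \<Sigma> \<alpha> ys, backward_estimate \<Sigma> \<beta> zs)"
  using assms
proof (induction arbitrary: thesis)
  case (init p)
  then obtain y z where "p = (inits_at \<Sigma> y, states_at \<Sigma> z)"
    by (auto simp: ver_inits_def)
  then show ?case
    by (intro init.prems[of "[]" "[]" "[y]" "[z]"]) (simp_all add: state_estimate_Nil inits_at_def)
next
  case (step p w p')
  obtain \<alpha> \<beta> ys zs where estimates: "\<alpha> \<in> lists (inputs \<Sigma>)" "\<beta> \<in> lists (inputs \<Sigma>)"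
      "p = (forward_estimate \<Sigma> \<alpha> ys, backward_estimate \<Sigma> \<beta> zs)"
    by (rule step.IH)
  from step.hyps(3) show ?case
  proof cases
    case (forward u y)
    with estimates show ?thesis
      by (intro step.prems[of "\<alpha> @ [u]" \<beta> "ys @ [y]" zs]) (simp_all add: state_estimate_snoc)
  next
    case (backward u z)
    with estimates show ?thesis
      by (intro step.prems[of \<alpha> "u # \<beta>" ys "z # zs"]) (simp_all add: backward_estimate_Cons)
  qed
qed

lemma ver_states_intersections:
  assumes "nfts \<Sigma>"
  shows "{q\<^sub>1 \<inter> q\<^sub>2 | q\<^sub>1 q\<^sub>2. (q\<^sub>1, q\<^sub>2) \<in> ver_states \<Sigma>} - {{}} = run_estimates \<Sigma>"
  (is "?L = ?R")
proof (intro equalityI subsetI)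
  fix E assume "E \<in> ?L"
  then obtain q\<^sub>1 q\<^sub>2 where "(q\<^sub>1, q\<^sub>2) \<in> ver_states \<Sigma>" "E = q\<^sub>1 \<inter> q\<^sub>2" "E \<noteq> {}"
    by blast
  then obtain \<alpha> \<beta> ys zs where inputs: "\<alpha> \<in> lists (inputs \<Sigma>)" "\<beta> \<in> lists (inputs \<Sigma>)"
    and "E = forward_estimate \<Sigma> \<alpha> ys \<inter> backward_estimate \<Sigma> \<beta> zs" and nonempty: "E \<noteq> {}"
    by (metis Pair_inject ver_statesE)
  then have "E = state_estimate \<Sigma> (inits \<Sigma>) (\<alpha> @ \<beta>) (ys @ tl zs) (length \<alpha>)"
    using forward_estimate_Int_backward_estimate by metis
  moreover have "\<alpha> @ \<beta> \<in> lists (inputs \<Sigma>)" "length \<alpha> \<le> length (\<alpha> @ \<beta>)"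
    using inputs by simp_all
  ultimately show "E \<in> ?R" using nonempty unfolding run_estimates_def by blast
next
  fix E assume "E \<in> ?R"
  then obtain \<alpha> ys i where inputs: "\<alpha> \<in> lists (inputs \<Sigma>)" and i_le: "i \<le> length \<alpha>"
    and E_eq: "E = state_estimate \<Sigma> (inits \<Sigma>) \<alpha> ys i" and nonempty: "E \<noteq> {}"
    unfolding run_estimates_def by blast
  let ?F = "forward_estimate \<Sigma> (take i \<alpha>) (take (Suc i) ys)"
  let ?B = "backward_estimate \<Sigma> (drop i \<alpha>) (drop i ys)"
  have split: "E = ?F \<inter> ?B"
    using i_le by (simp add: E_eq state_estimate_split[OF i_le, of \<Sigma> "inits \<Sigma>" ys] min_absorb2)
  have "take i \<alpha> \<in> lists (inputs \<Sigma>)" "drop i \<alpha> \<in> lists (inputs \<Sigma>)"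
    using inputs by (auto dest: in_set_takeD in_set_dropD)
  with assms have "(?F, ?B) \<in> ver_states \<Sigma>"
    using split nonempty by (intro forward_estimate_backward_estimate_ver_states) auto
  with split nonempty show "E \<in> ?L" by blast
qed

lemma run_subset_states:
  assumes "nfts \<Sigma>" "run \<Sigma> \<alpha> xs"
  shows "set xs \<subseteq> states \<Sigma>"
proof -
  have "xs ! j \<in> states \<Sigma>" if "j < length xs" for j
  proof (cases j)
    case 0
    with assms show ?thesis by (auto simp: run_def nfts_def)
  next
    case (Suc i)
    with assms(2) that have "(xs ! i, \<alpha> ! i, xs ! j) \<in> transitions \<Sigma>"
      by (simp add: run_def)
    with assms(1) show ?thesis by (auto simp: nfts_def)
  qed
  then show ?thesis by (auto simp: in_set_conv_nth)
qed

lemma maximal_run_length: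
  assumes "total_nfts \<Sigma>" "\<alpha> \<in> lists (inputs \<Sigma>)" "maximal_run \<Sigma> \<alpha> xs"
  shows "length xs = Suc (length \<alpha>)"
proof (rule ccontr)
  let ?k = "length xs - 1"
  assume "length xs \<noteq> Suc (length \<alpha>)"
  moreover have run: "run \<Sigma> \<alpha> xs"
    using assms(3) by (simp add: maximal_run_def)
  ultimately have "?k < length xs" "?k < length \<alpha>"
    by (cases xs; simp add: run_def)+
  then have "xs ! ?k \<in> states \<Sigma>" "\<alpha> ! ?k \<in> inputs \<Sigma>"
    using assms(1,2) run_subset_states[OF _ run] by (auto simp: total_nfts_def in_lists_conv_set)
  then have "\<exists>x'. (xs ! ?k, \<alpha> ! ?k, x') \<in> transitions \<Sigma>"
    using assms(1) by (simp add: total_nfts_def)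
  with assms(3) \<open>?k < length \<alpha>\<close> show False
    by (auto simp: maximal_run_def Let_def)
qed

lemma maximal_run_iff_path:
  assumes "total_nfts \<Sigma>" "\<alpha> \<in> lists (inputs \<Sigma>)"
  shows "maximal_run \<Sigma> \<alpha> xs \<longleftrightarrow> path \<Sigma> \<alpha> xs \<and> xs ! 0 \<in> inits \<Sigma>"
proof
  assume maximal: "maximal_run \<Sigma> \<alpha> xs"
  then have run: "run \<Sigma> \<alpha> xs" by (simp add: maximal_run_def)
  moreover have "set xs \<subseteq> states \<Sigma>"
    using assms(1) run by (intro run_subset_states) (simp_all add: total_nfts_def)
  ultimately show "path \<Sigma> \<alpha> xs \<and> xs ! 0 \<in> inits \<Sigma>"
    using maximal_run_length[OF assms maximal] by (simp add: path_def run_def)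
next
  assume "path \<Sigma> \<alpha> xs \<and> xs ! 0 \<in> inits \<Sigma>"
  then show "maximal_run \<Sigma> \<alpha> xs"
    by (auto simp: path_def maximal_run_def run_def)
qed

lemma infinite_step_opaque_iff_run_estimates:
  assumes "total_nfts \<Sigma>"
  shows "infinite_step_opaque \<Sigma> \<longleftrightarrow> (\<forall>E\<in>run_estimates \<Sigma>. \<not> E \<subseteq> secrets \<Sigma>)"
proof -
  have indistinguishable: "length xs' = length xs \<and> P \<and>
      (\<forall>j < length xs. obs \<Sigma> (xs ! j) = obs \<Sigma> (xs' ! j)) \<longleftrightarrow>
      map (obs \<Sigma>) xs' = map (obs \<Sigma>) xs \<and> P" for xs xs' P
    by (auto simp: list_eq_iff_nth_eq)
  have path_times: "(path \<Sigma> \<alpha> xs \<and> P \<longrightarrow> (\<forall>i < length xs. Q i)) \<longleftrightarrow>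
      (path \<Sigma> \<alpha> xs \<and> P \<longrightarrow> (\<forall>i \<le> length \<alpha>. Q i))" for \<alpha> xs P Q
    by (auto simp: path_length)
  have "infinite_step_opaque \<Sigma> \<longleftrightarrow>
    (\<forall>\<alpha>\<in>lists (inputs \<Sigma>). \<forall>xs. path \<Sigma> \<alpha> xs \<and> xs ! 0 \<in> inits \<Sigma> \<longrightarrow>
       (\<forall>i\<le>length \<alpha>. xs ! i \<in> secrets \<Sigma> \<longrightarrow>
          (\<exists>xs'. path \<Sigma> \<alpha> xs' \<and> xs' ! 0 \<in> inits \<Sigma> \<and>
             map (obs \<Sigma>) xs' = map (obs \<Sigma>) xs \<and> xs' ! i \<notin> secrets \<Sigma>)))"
    unfolding infinite_step_opaque_def indistinguishable
    by (simp only: maximal_run_iff_path[OF assms] path_times conj_assoc cong: ball_cong)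
  also have "\<dots> \<longleftrightarrow>
    (\<forall>\<alpha>\<in>lists (inputs \<Sigma>). \<forall>ys. \<forall>i\<le>length \<alpha>. state_estimate \<Sigma> (inits \<Sigma>) \<alpha> ys i \<noteq> {} \<longrightarrow>
       \<not> state_estimate \<Sigma> (inits \<Sigma>) \<alpha> ys i \<subseteq> secrets \<Sigma>)"
    unfolding state_estimate_def by blast
  also have "\<dots> \<longleftrightarrow> (\<forall>E\<in>run_estimates \<Sigma>. \<not> E \<subseteq> secrets \<Sigma>)"
    unfolding run_estimates_def by blast
  finally show ?thesis .
qed

theorem theorem5p5:
  fixes \<Sigma> :: "('x, 'u, 'y) nfts_data"
  assumes "total_nfts \<Sigma>"
  shows "infinite_step_opaque \<Sigma> \<longleftrightarrow>
    (\<forall>(q\<^sub>1, q\<^sub>2) \<in> ver_states \<Sigma>. q\<^sub>1 \<inter> q\<^sub>2 \<noteq> {} \<longrightarrow> \<not> q\<^sub>1 \<inter> q\<^sub>2 \<subseteq> secrets \<Sigma>)"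
proof -
  have "nfts \<Sigma>" using assms by (simp add: total_nfts_def)
  have "infinite_step_opaque \<Sigma> \<longleftrightarrow> (\<forall>E\<in>run_estimates \<Sigma>. \<not> E \<subseteq> secrets \<Sigma>)"
    by (rule infinite_step_opaque_iff_run_estimates[OF assms])
  also have "\<dots> \<longleftrightarrow> (\<forall>(q\<^sub>1, q\<^sub>2) \<in> ver_states \<Sigma>. q\<^sub>1 \<inter> q\<^sub>2 \<noteq> {} \<longrightarrow> \<not> q\<^sub>1 \<inter> q\<^sub>2 \<subseteq> secrets \<Sigma>)"
    unfolding ver_states_intersections[OF \<open>nfts \<Sigma>\<close>, symmetric] by blast
  finally show ?thesis .
qed

end
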